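(* Let $n\geq 1$, let $p(\overline{x_n})$ be a polynomial with integer coefficients in the unknowns $x_1,\ldots,x_n$, let $F$ be a function variable of arity $n$, and let $(\mathcal{U},\mathcal{A},F)$ be the ASOGU problem induced by $p(\overline{x_n})$, where $\mathcal{U}=\{\mathrm{cvt}[F,p(\overline{x_n})]^-\stackrel{?}{=}_F\mathrm{cvt}[F,p(\overline{x_n})]^+\}$. Then $$p(\overline{x_n})=\mathrm{cnt}[F,\overline{x_n},a,\mathcal{U}]_r-\mathrm{cnt}[F,\overline{x_n},a,\mathcal{U}]_l\qquad\text{and}\qquad 0=\mathrm{mul}[F,\overline{x_n},\mathcal{U}]_l-\mathrm{mul}[F,\overline{x_n},\mathcal{U}]_r.$$
   Context: The signature $\Sigma$ is finite and contains a binary symbol $g$ and a constant $a$; $\mathcal{A}=\{g(x,g(y,z))=g(g(x,y),z)\}$. Terms are written in flattened form: $g(u_1,\ldots,u_m)$ with $m\geq 2$ stands for a nested application of $g$ to $u_1,\ldots,u_m$ in this order (say right-nested), and $a^k$ stands for a sequence of $k$ copies of $a$. A function variable $F$ of arity $n$ is applied to $n$ argument terms. $\overline{x_n}$ abbreviates $x_1,\ldots,x_n$. Monomial groupings. Polynomials are in reduced form (a sum of monomials, like terms combined), with integer coefficients. For each polynomial $p(\overline{x_n})$ a total linear order $<_p$ on $x_1,\ldots,x_n$ is fixed. $p_0\in\mathbb{Z}$ denotes the constant term of $p$. For $1\leq j\leq n$, $p_{x_j}$ is the sum of those monomials of $p$ that are divisible by $x_j$ and not divisible by any $x_i$ with $x_i<_p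 x_j$ (and $p_{x_j}=0$ if there are none). Writing $p_{x_j}=x_j\cdot p'$, the reduction is $p_{x_j}\!\downarrow\;=p'$. $n$-converter. The terms $\mathrm{cvt}[F,p]^+$ and $\mathrm{cvt}[F,p]^-$ are defined recursively. If $p=c$ is constant: $\mathrm{cvt}[F,p]^+=g(a^{c+1})$ if $c\geq 1$ and $\mathrm{cvt}[F,p]^+=a$ if $c\leq 0$; $\mathrm{cvt}[F,p]^-=g(a^{|c|+1})$ if $c<0$ and $\mathrm{cvt}[F,p]^-=a$ if $c\geq 0$. If $p\neq p_0$, put $c=p_0$ and, for $\star\in\{+,-\}$ and $1\leq i\leq n$, $t_i^\star=\mathrm{cvt}[F,p_{x_i}\!\downarrow]^\star$; then $\mathrm{cvt}[F,p]^+=g(a^{c},F(t_1^+,\ldots,t_n^+))$ if $c\geq 1$ and $\mathrm{cvt}[F,p]^+=F(t_1^+,\ldots,t_n^+)$ if $c\leq 0$; $\mathrm{cvt}[F,p]^-=g(a^{|c|},F(t_1^-,\ldots,t_n^-))$ if $c<0$ and $\mathrm{cvt}[F,p]^-=F(t_1^-,\ldots,t_n^-)$ if $c\geq 0$. The ASOGU (associative second-order ground unification) problem induced by $p$ is $(\mathcal{U},\mathcal{A},F)$ with $\mathcal{U}=\{\mathrm{cvt}[F,p]^-\stackrel{?}{=}_F\mathrm{cvt}[F,p]^+\}$. Multiplier and counter (for $\overline{h_n}=h_1,\ldots,h_n$ non-negative integers, or, as here, the unknowns $x_1,\ldots,x_n$ themselves ranging over the natural numbers, so that the values are polynomials in $\overline{x_n}$).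 $\mathrm{mul}[F,\overline{h_n},t]$ is $0$ if $t$ is a constant; $\mathrm{mul}[F,\overline{h_n},f(t_1,\ldots,t_l)]=\sum_{j}\mathrm{mul}[F,\overline{h_n},t_j]$ for $f\in\Sigma$; $\mathrm{mul}[F,\overline{h_n},F(t_1,\ldots,t_n)]=1+\sum_{i=1}^n h_i\cdot\mathrm{mul}[F,\overline{h_n},t_i]$. For $b\in\Sigma$ and $f\in\Sigma$ of arity $l\geq 0$, $\mathrm{cnt}[F,\overline{h_n},b,f(t_1,\ldots,t_l)]=\delta+\sum_{j=1}^l\mathrm{cnt}[F,\overline{h_n},b,t_j]$ with $\delta=1$ if $f=b$ and $\delta=0$ otherwise; $\mathrm{cnt}[F,\overline{h_n},b,F(t_1,\ldots,t_n)]=\sum_{i=1}^n h_i\cdot\mathrm{cnt}[F,\overline{h_n},b,t_i]$. For a set $\mathcal{U}$ of equations, the subscript $l$ (resp. $r$) denotes the sum of the corresponding values over all left-hand (resp. right-hand) sides of the equations in $\mathcal{U}$. *)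

theory Defs
  imports "HOL-Library.Poly_Mapping"
begin

section \<open>Integer polynomials and monomial groupings\<close>

text \<open>Monomials are finitely supported exponent vectors, and a polynomial maps each monomial to
  its coefficient; this is the reduced form, so equality is equality of polynomials.
  The unknowns of a polynomial in \<open>n\<close> unknowns are those with indices \<open>1, \<dots>, n\<close>.\<close>

type_synonym int_mpoly = "(nat \<Rightarrow>\<^sub>0 nat) \<Rightarrow>\<^sub>0 int"

definition X :: "nat \<Rightarrow> int_mpoly" where
  "X i = Poly_Mapping.single (Poly_Mapping.single i 1) 1"

definition unknowns :: "int_mpoly \<Rightarrow> nat set" where
  "unknowns p = (\<Union>m \<in> Poly_Mapping.keys p. Poly_Mapping.keys m)"

definition const_term :: "int_mpoly \<Rightarrow> int" where
  "const_term p = Poly_Mapping.lookup p 0"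

definition const_poly :: "int \<Rightarrow> int_mpoly" where
  "const_poly c = Poly_Mapping.single 0 c"

text \<open>\<open>(i, j) \<in> lt p\<close> means that \<open>x\<^sub>i\<close> precedes \<open>x\<^sub>j\<close> in the strict order fixed for \<open>p\<close>.\<close>

type_synonym unknown_orders = "int_mpoly \<Rightarrow> (nat \<times> nat) set"

definition group_monomials ::
    "unknown_orders \<Rightarrow> nat \<Rightarrow> int_mpoly \<Rightarrow> nat \<Rightarrow> (nat \<Rightarrow>\<^sub>0 nat) set" where
  "group_monomials lt n p j =
     {m \<in> Poly_Mapping.keys p. Poly_Mapping.lookup m j \<noteq> 0 \<and>
        (\<forall>i \<in> {1..n}. (i, j) \<in> lt p \<longrightarrow> Poly_Mapping.lookup m i = 0)}"

definition group :: "unknown_orders \<Rightarrow> nat \<Rightarrow> int_mpoly \<Rightarrow> nat \<Rightarrow> int_mpoly" where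
  "group lt n p j =
     (\<Sum>m \<in> group_monomials lt n p j. Poly_Mapping.single m (Poly_Mapping.lookup p m))"

definition reduction :: "unknown_orders \<Rightarrow> nat \<Rightarrow> int_mpoly \<Rightarrow> nat \<Rightarrow> int_mpoly" where
  "reduction lt n p j = (THE p'. group lt n p j = X j * p')"

text \<open>The remaining facts of this section show that the reduction is well defined and that it
  lowers the total degree, which is what the recursion of the converter needs.\<close>

lemma X_nonzero: "X j \<noteq> 0"
  by (metis X_def lookup_single_eq lookup_zero zero_neq_one)

lemma X_cancel:
  assumes "X j * q = X j * r"
  shows "q = r"
  using assms by (simp only: mult_left_cancel[OF X_nonzero])

lemma monomial_split:
  fixes m :: "nat \<Rightarrow>\<^sub>0 nat"
  assumes "Poly_Mapping.lookup m j \<noteq> 0"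
  shows "Poly_Mapping.single j 1 + (m - Poly_Mapping.single j 1) = m"
  using assms by (intro poly_mapping_eqI) (auto simp: lookup_add lookup_minus lookup_single when_def)

definition explicit_reduction :: "unknown_orders \<Rightarrow> nat \<Rightarrow> int_mpoly \<Rightarrow> nat \<Rightarrow> int_mpoly" where
  "explicit_reduction lt n p j =
     (\<Sum>m \<in> group_monomials lt n p j.
        Poly_Mapping.single (m - Poly_Mapping.single j 1) (Poly_Mapping.lookup p m))"

lemma group_eq_explicit: "group lt n p j = X j * explicit_reduction lt n p j"
  unfolding group_def explicit_reduction_def sum_distrib_left
  by (rule sum.cong) (auto simp: X_def mult_single monomial_split[simplified] group_monomials_def)

lemma reduction_eq_explicit: "reduction lt n p j = explicit_reduction lt n p j"
  unfolding reduction_def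
proof (rule the_equality)
  show "group lt n p j = X j * explicit_reduction lt n p j" by (rule group_eq_explicit)
next
  fix p'
  assume "group lt n p j = X j * p'"
  then have "X j * p' = X j * explicit_reduction lt n p j" by (simp only: group_eq_explicit)
  then show "p' = explicit_reduction lt n p j" by (rule X_cancel)
qed

lemma group_eq_reduction: "group lt n p j = X j * reduction lt n p j"
  by (simp add: group_eq_explicit reduction_eq_explicit)

definition monomial_degree :: "(nat \<Rightarrow>\<^sub>0 nat) \<Rightarrow> nat" where
  "monomial_degree m = Sum_any (Poly_Mapping.lookup m)"

definition total_degree :: "int_mpoly \<Rightarrow> nat" where
  "total_degree p = Max (insert 0 (monomial_degree ` Poly_Mapping.keys p))"

lemma monomial_degree_add: "monomial_degree (m + k) = monomial_degree m + monomial_degree k"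
  by (simp add: monomial_degree_def lookup_add Sum_any.distrib)

lemma monomial_degree_single: "monomial_degree (Poly_Mapping.single j c) = c"
  by (simp add: monomial_degree_def lookup_single)

lemma monomial_degree_split:
  assumes "Poly_Mapping.lookup m j \<noteq> 0"
  shows "monomial_degree m = 1 + monomial_degree (m - Poly_Mapping.single j 1)"
  using monomial_degree_add[of "Poly_Mapping.single j 1" "m - Poly_Mapping.single j 1"]
  by (simp only: monomial_split[OF assms] monomial_degree_single)

lemma monomial_degree_pos:
  assumes "m \<noteq> 0"
  shows "0 < monomial_degree m"
proof -
  obtain j where "Poly_Mapping.lookup m j \<noteq> 0"
    using assms by (metis lookup_zero poly_mapping_eqI)
  then show ?thesis by (simp add: monomial_degree_split)
qed

lemma total_degree_reduction:
  assumes "p \<noteq> const_poly (const_term p)"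
  shows "total_degree (reduction lt n p j) < total_degree p"
proof -
  have le: "monomial_degree m \<le> total_degree p" if "m \<in> Poly_Mapping.keys p" for m
    using that by (simp add: total_degree_def)
  obtain m where m: "Poly_Mapping.lookup p m \<noteq> Poly_Mapping.lookup (const_poly (const_term p)) m"
    using assms by (meson poly_mapping_eqI)
  then have "m \<noteq> 0" by (auto simp: const_poly_def const_term_def)
  with m have "m \<in> Poly_Mapping.keys p"
    by (auto simp: const_poly_def lookup_single in_keys_iff)
  with \<open>m \<noteq> 0\<close> have pos: "0 < total_degree p"
    using le monomial_degree_pos by (meson less_le_trans)
  have "monomial_degree k < total_degree p"
    if k: "k \<in> Poly_Mapping.keys (reduction lt n p j)" for k
  proof -
    have "k \<in> (\<Union>m \<in> group_monomials lt n p j.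
            Poly_Mapping.keys (Poly_Mapping.single (m - Poly_Mapping.single j 1)
              (Poly_Mapping.lookup p m)))"
      using k unfolding reduction_eq_explicit explicit_reduction_def by (rule subsetD[OF keys_sum])
    then obtain m where m: "m \<in> group_monomials lt n p j" "k = m - Poly_Mapping.single j 1"
      by (auto split: if_splits)
    then have "monomial_degree m = 1 + monomial_degree k"
      using monomial_degree_split by (simp add: group_monomials_def)
    moreover have "m \<in> Poly_Mapping.keys p" using m by (simp add: group_monomials_def)
    ultimately show ?thesis using le by fastforce
  qed
  then show ?thesis using pos by (simp add: total_degree_def[of "reduction lt n p j"])
qed

section \<open>Terms and associative second-order ground unification problems\<close>

text \<open>A function variable carries its arity. The terms of a problem are ground in the sense that
  they have no individual variables; those occur only in the axioms.\<close>

datatype fvar = FVar (fvar_name: nat) (fvar_arity: nat)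

datatype 'f so_term = Fun 'f "'f so_term list" | FApp fvar "'f so_term list"

datatype 'f fo_term = FOVar nat | FOFun 'f "'f fo_term list"

type_synonym 'f equations = "('f so_term \<times> 'f so_term) set"

type_synonym 'f axioms = "('f fo_term \<times> 'f fo_term) set"

type_synonym 'f asogu = "'f equations \<times> 'f axioms \<times> fvar"

definition assoc_axioms :: "'f \<Rightarrow> 'f axioms" where
  "assoc_axioms g =
     {(FOFun g [FOVar 0, FOFun g [FOVar 1, FOVar 2]],
       FOFun g [FOFun g [FOVar 0, FOVar 1], FOVar 2])}"

text \<open>The flattened form \<open>g(u\<^sub>1, \<dots>, u\<^sub>m)\<close>, used for \<open>m \<ge> 2\<close>; the one-element case only closes the
  recursion.\<close>

fun flat :: "'f \<Rightarrow> 'f so_term list \<Rightarrow> 'f so_term" where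
  "flat g [u] = u"
| "flat g (u # v # us) = Fun g [u, flat g (v # us)]"

section \<open>The converter\<close>

function cvt_plus :: "'f \<Rightarrow> 'f \<Rightarrow> unknown_orders \<Rightarrow> fvar \<Rightarrow> int_mpoly \<Rightarrow> 'f so_term" where
  "cvt_plus g a lt F p =
     (let n = fvar_arity F; c = const_term p in
      if p = const_poly c then
        (if c \<ge> 1 then flat g (replicate (nat c + 1) (Fun a [])) else Fun a [])
      else
        (let t = FApp F (map (\<lambda>i. cvt_plus g a lt F (reduction lt n p i)) [1..<n + 1]) in
         if c \<ge> 1 then flat g (replicate (nat c) (Fun a []) @ [t]) else t))"
  by pat_completeness auto
termination
  by (relation "measure (\<lambda>(g, a, lt, F, p). total_degree p)")
     (auto intro: total_degree_reduction)

function cvt_minus :: "'f \<Rightarrow> 'f \<Rightarrow> unknown_orders \<Rightarrow> fvar \<Rightarrow> int_mpoly \<Rightarrow> 'f so_term" where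
  "cvt_minus g a lt F p =
     (let n = fvar_arity F; c = const_term p in
      if p = const_poly c then
        (if c < 0 then flat g (replicate (nat \<bar>c\<bar> + 1) (Fun a [])) else Fun a [])
      else
        (let t = FApp F (map (\<lambda>i. cvt_minus g a lt F (reduction lt n p i)) [1..<n + 1]) in
         if c < 0 then flat g (replicate (nat \<bar>c\<bar>) (Fun a []) @ [t]) else t))"
  by pat_completeness auto
termination
  by (relation "measure (\<lambda>(g, a, lt, F, p). total_degree p)")
     (auto intro: total_degree_reduction)

declare cvt_plus.simps [simp del] cvt_minus.simps [simp del]

definition induced_asogu :: "'f \<Rightarrow> 'f \<Rightarrow> unknown_orders \<Rightarrow> fvar \<Rightarrow> int_mpoly \<Rightarrow> 'f asogu" where
  "induced_asogu g a lt F p = ({(cvt_minus g a lt F p, cvt_plus g a lt F p)}, assoc_axioms g, F)"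

section \<open>Multiplier and counter\<close>

lemma size_nth_less [termination_simp]:
  assumes "Suc 0 \<le> i" and "i \<le> length ts"
  shows "size (ts ! (i - Suc 0)) < Suc (size_list size ts)"
proof -
  have "ts ! (i - Suc 0) \<in> set ts" using assms by (intro nth_mem) linarith
  then show ?thesis using size_list_estimation'[OF _ order_refl] by (intro le_imp_less_Suc)
qed

text \<open>The values \<open>h 1, \<dots>, h n\<close> may be natural numbers or polynomials, hence the general
  semiring. Only terms whose sole function variable is \<open>F\<close> are considered; on other function
  variables multiplier and counter are left unspecified.\<close>

fun mul :: "fvar \<Rightarrow> (nat \<Rightarrow> 'r::comm_semiring_1) \<Rightarrow> 'f so_term \<Rightarrow> 'r" where
  "mul F h (Fun f ts) = (\<Sum>t\<leftarrow>ts. mul F h t)"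
| "mul F h (FApp G ts) =
     (if G = F then 1 + (\<Sum>i = 1..length ts. h i * mul F h (ts ! (i - 1))) else undefined)"

fun cnt :: "fvar \<Rightarrow> (nat \<Rightarrow> 'r::comm_semiring_1) \<Rightarrow> 'f \<Rightarrow> 'f so_term \<Rightarrow> 'r" where
  "cnt F h b (Fun f ts) = (if f = b then 1 else 0) + (\<Sum>t\<leftarrow>ts. cnt F h b t)"
| "cnt F h b (FApp G ts) =
     (if G = F then (\<Sum>i = 1..length ts. h i * cnt F h b (ts ! (i - 1))) else undefined)"

definition mul_l :: "fvar \<Rightarrow> (nat \<Rightarrow> 'r::comm_semiring_1) \<Rightarrow> 'f equations \<Rightarrow> 'r" where
  "mul_l F h U = (\<Sum>(s, t) \<in> U. mul F h s)"

definition mul_r :: "fvar \<Rightarrow> (nat \<Rightarrow> 'r::comm_semiring_1) \<Rightarrow> 'f equations \<Rightarrow> 'r" where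
  "mul_r F h U = (\<Sum>(s, t) \<in> U. mul F h t)"

definition cnt_l :: "fvar \<Rightarrow> (nat \<Rightarrow> 'r::comm_semiring_1) \<Rightarrow> 'f \<Rightarrow> 'f equations \<Rightarrow> 'r" where
  "cnt_l F h b U = (\<Sum>(s, t) \<in> U. cnt F h b s)"

definition cnt_r :: "fvar \<Rightarrow> (nat \<Rightarrow> 'r::comm_semiring_1) \<Rightarrow> 'f \<Rightarrow> 'f equations \<Rightarrow> 'r" where
  "cnt_r F h b U = (\<Sum>(s, t) \<in> U. cnt F h b t)"

end

theory Submission
  imports Defs
begin

text \<open>Every non-constant monomial of \<open>p\<close> lies in exactly one group, that of the
  \<open><\<^sub>p\<close>-least unknown dividing it, so \<open>p\<close> is its constant term plus the sum of
  \<open>x\<^sub>j\<close> times the reductions. The two converters share their \<open>F\<close>-skeleton and differ only in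
  where occurrences of \<open>a\<close> are placed; the difference of the counters therefore satisfies the same
  recursion as \<open>p\<close>, while the multipliers, which ignore constants, agree.\<close>

lemma of_int_eq_const_poly: "of_int c = const_poly c"
  by (rule poly_mapping_eqI) (simp add: const_poly_def lookup_of_int lookup_single when_def)

lemma lookup_group:
  "Poly_Mapping.lookup (group lt n p j) m =
     (if m \<in> group_monomials lt n p j then Poly_Mapping.lookup p m else 0)"
proof -
  have "finite (group_monomials lt n p j)"
    by (simp add: group_monomials_def)
  then show ?thesis
    by (simp add: group_def lookup_sum lookup_single when_def)
qed

text \<open>A least element of the finite nonempty set of unknowns dividing \<open>m\<close> gives
  existence; totality of \<open>lt p\<close> gives uniqueness.\<close>

lemma ex1_group_monomials:
  assumes "strict_linear_order_on {1..n} (lt p)"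
    and "m \<in> Poly_Mapping.keys p" "m \<noteq> 0" "Poly_Mapping.keys m \<subseteq> {1..n}"
  shows "\<exists>!j. j \<in> {1..n} \<and> m \<in> group_monomials lt n p j"
proof -
  have ord: "trans (lt p)" "irrefl (lt p)" "total_on {1..n} (lt p)"
    using assms(1) by (auto simp: strict_linear_order_on_def)
  have "asymp_on (Poly_Mapping.keys m) (\<lambda>i j. (i, j) \<in> lt p)"
    using ord unfolding asymp_on_def irrefl_def trans_def by blast
  moreover have "transp_on (Poly_Mapping.keys m) (\<lambda>i j. (i, j) \<in> lt p)"
    using ord unfolding transp_on_def trans_def by blast
  moreover have "Poly_Mapping.keys m \<noteq> {}"
    using assms(3) by simp
  ultimately obtain j where j: "j \<in> Poly_Mapping.keys m"
      "\<And>i. i \<in> Poly_Mapping.keys m \<Longrightarrow> i \<noteq> j \<Longrightarrow> (i, j) \<notin> lt p"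
    using Finite_Set.bex_min_element[of "Poly_Mapping.keys m" "\<lambda>i j. (i, j) \<in> lt p"] by auto
  show ?thesis
  proof (rule ex1I[of _ j])
    show "j \<in> {1..n} \<and> m \<in> group_monomials lt n p j"
    proof
      show "j \<in> {1..n}"
        using j(1) assms(4) by blast
      show "m \<in> group_monomials lt n p j"
        \<comment> \<open>Minimality of \<open>j\<close> speaks only of \<open>i \<noteq> j\<close>;
          irreflexivity covers \<open>i = j\<close>.\<close>
        using j assms(2) ord(2) by (auto simp: group_monomials_def in_keys_iff irrefl_def)
    qed
  next
    fix k assume k: "k \<in> {1..n} \<and> m \<in> group_monomials lt n p k"
    have "j \<in> {1..n}"
      using j(1) assms(4) by blast
    \<comment> \<open>If \<open>j\<close> preceded \<open>k\<close>, membership in the group of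
      \<open>k\<close> would force the exponent of \<open>j\<close> in \<open>m\<close> to be
      zero.\<close>
    with k have "k \<in> Poly_Mapping.keys m" "(j, k) \<notin> lt p"
      using j(1) by (auto simp: group_monomials_def in_keys_iff)
    then show "k = j"
      using j assms(4) ord(3) by (metis subsetD total_on_def)
  qed
qed

text \<open>Coefficients are compared monomial by monomial: the monomial \<open>0\<close> lies in no
  group, and every other monomial of \<open>p\<close> is contributed by exactly one.\<close>

lemma group_decomposition:
  assumes "strict_linear_order_on {1..n} (lt p)" and "unknowns p \<subseteq> {1..n}"
  shows "p = of_int (const_term p) + (\<Sum>j = 1..n. group lt n p j)"
proof (rule poly_mapping_eqI)
  fix m
  have rhs: "Poly_Mapping.lookup (of_int (const_term p) + (\<Sum>j = 1..n. group lt n p j)) m =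
      (if m = 0 then const_term p else 0) +
      (\<Sum>j = 1..n. if m \<in> group_monomials lt n p j then Poly_Mapping.lookup p m else 0)"
    by (simp add: of_int_eq_const_poly const_poly_def lookup_add lookup_sum lookup_group
        lookup_single when_def)
  show "Poly_Mapping.lookup p m =
      Poly_Mapping.lookup (of_int (const_term p) + (\<Sum>j = 1..n. group lt n p j)) m"
  proof (cases "m = 0 \<or> m \<notin> Poly_Mapping.keys p")
    case True
    then have "m \<notin> group_monomials lt n p j" for j
      by (auto simp: group_monomials_def)
    with True show ?thesis
      unfolding rhs by (auto simp: const_term_def in_keys_iff)
  next
    case False
    then have "Poly_Mapping.keys m \<subseteq> {1..n}"
      using assms(2) by (auto simp: unknowns_def)
    then obtain j where j: "j \<in> {1..n}"
        "\<And>k. k \<in> {1..n} \<Longrightarrow> m \<in> group_monomials lt n p k \<longleftrightarrow> k = j"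
      using ex1_group_monomials[where lt = lt, OF assms(1)] False by metis
    have "(\<Sum>k = 1..n. if m \<in> group_monomials lt n p k then Poly_Mapping.lookup p m else 0) =
        (\<Sum>k = 1..n. if k = j then Poly_Mapping.lookup p m else 0)"
      using j(2) by (intro sum.cong) auto
    with False j(1) show ?thesis
      unfolding rhs by simp
  qed
qed

text \<open>Dividing a monomial by an unknown never raises an exponent. This keeps the induction on
  the converter within the unknowns \<open>1\<close> to \<open>n\<close>.\<close>

lemma unknowns_reduction: "unknowns (reduction lt n p j) \<subseteq> unknowns p"
proof
  fix i assume "i \<in> unknowns (reduction lt n p j)"
  then obtain k where k: "k \<in> Poly_Mapping.keys (reduction lt n p j)" "i \<in> Poly_Mapping.keys k"
    by (auto simp: unknowns_def)
  from k(1) have "k \<in> (\<Union>m \<in> group_monomials lt n p j.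
      Poly_Mapping.keys (Poly_Mapping.single (m - Poly_Mapping.single j 1)
        (Poly_Mapping.lookup p m)))"
    unfolding reduction_eq_explicit explicit_reduction_def by (rule subsetD[OF keys_sum])
  then obtain m where "m \<in> Poly_Mapping.keys p" "k = m - Poly_Mapping.single j 1"
    by (auto simp: group_monomials_def split: if_splits)
  moreover have "i \<in> Poly_Mapping.keys m"
    using k(2) calculation(2) by (auto simp: in_keys_iff lookup_minus)
  ultimately show "i \<in> unknowns p"
    by (auto simp: unknowns_def)
qed

text \<open>Flattening inserts only copies of \<open>g\<close>, which are invisible when counting
  some \<open>b \<noteq> g\<close>.\<close>

lemma cnt_flat:
  assumes "us \<noteq> []" and "b \<noteq> g"
  shows "cnt F h b (flat g us) = (\<Sum>u\<leftarrow>us. cnt F h b u)"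
  using assms by (induction g us rule: flat.induct) auto

lemma mul_flat:
  assumes "us \<noteq> []"
  shows "mul F h (flat g us) = (\<Sum>u\<leftarrow>us. mul F h u)"
  using assms by (induction g us rule: flat.induct) auto

text \<open>List positions start at 0 and unknowns at 1; here the shift \<open>i - 1\<close> in
  \<open>cnt\<close> cancels against the range starting at \<open>Suc 0\<close>.\<close>

lemma cnt_FApp_map:
  "cnt F h b (FApp F (map t [Suc 0..<Suc n])) = (\<Sum>i = 1..n. h i * cnt F h b (t i))"
  by (auto simp del: upt_Suc intro!: sum.cong)

lemma mul_FApp_map:
  "mul F h (FApp F (map t [Suc 0..<Suc n])) = 1 + (\<Sum>i = 1..n. h i * mul F h (t i))"
  by (auto simp del: upt_Suc intro!: sum.cong arg_cong[where f = "(+) 1"])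

lemma mul_cvt_eq: "mul F h (cvt_plus g a lt F p) = mul F h (cvt_minus g a lt F p)"
proof (induction "total_degree p" arbitrary: p rule: less_induct)
  case less
  show ?case
  proof (cases "p = const_poly (const_term p)")
    case True
    then show ?thesis
      by (subst cvt_plus.simps, subst cvt_minus.simps)
        (auto simp: Let_def mul_flat sum_list_replicate simp del: replicate_Suc)
  next
    case False
    then have "mul F h (cvt_plus g a lt F (reduction lt n p i)) =
        mul F h (cvt_minus g a lt F (reduction lt n p i))" for n i
      using less total_degree_reduction by blast
    with False show ?thesis
      by (subst cvt_plus.simps, subst cvt_minus.simps)
        (simp add: Let_def mul_flat sum_list_replicate mul_FApp_map
          del: replicate_Suc upt_Suc mul.simps(2))
  qed
qed

text \<open>The order hypothesis ranges over all \<open>q\<close> because each reduction met in the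
  recursion is grouped by its own order.\<close>

lemma cnt_cvt_diff:
  fixes p :: int_mpoly
  assumes "\<And>q. unknowns q \<subseteq> {1..fvar_arity F} \<Longrightarrow> strict_linear_order_on {1..fvar_arity F} (lt q)"
    and "a \<noteq> g" and "unknowns p \<subseteq> {1..fvar_arity F}"
  shows "cnt F X a (cvt_plus g a lt F p) - cnt F X a (cvt_minus g a lt F p) = p"
  using assms(3)
proof (induction "total_degree p" arbitrary: p rule: less_induct)
  case less
  define n c where "n = fvar_arity F" and "c = const_term p"
  show ?case
  proof (cases "p = const_poly c")
    case True
    \<comment> \<open>Truncation by \<open>nat\<close> merges both branches: for
      \<open>c \<le> 0\<close> it yields 0 and leaves the single \<open>a\<close>.\<close>
    have "cnt F X a (cvt_plus g a lt F p) = of_nat (nat c) + 1"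
      using True assms(2) unfolding c_def
      by (subst cvt_plus.simps)
        (simp add: Let_def cnt_flat sum_list_replicate del: replicate_Suc)
    moreover have "cnt F X a (cvt_minus g a lt F p) = of_nat (nat (- c)) + 1"
      using True assms(2) unfolding c_def
      by (subst cvt_minus.simps)
        (simp add: Let_def cnt_flat sum_list_replicate del: replicate_Suc)
    \<comment> \<open>The positive part of \<open>c\<close> minus its negative part is
      \<open>c\<close>; the extra \<open>a\<close> on each side cancels.\<close>
    moreover have "p = of_int (int (nat c) - int (nat (- c)))"
      by (subst True) (simp add: of_int_eq_const_poly)
    ultimately show ?thesis
      by simp
  next
    case False
    let ?r = "\<lambda>i. reduction lt n p i"
    have IH: "cnt F X a (cvt_plus g a lt F (?r i)) - cnt F X a (cvt_minus g a lt F (?r i)) = ?r i"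
      for i
      using less False unknowns_reduction total_degree_reduction
      unfolding c_def by (meson subset_trans)
    have "cnt F X a (cvt_plus g a lt F p) =
        of_nat (nat c) + (\<Sum>i = 1..n. X i * cnt F X a (cvt_plus g a lt F (?r i)))"
      using False assms(2) unfolding c_def n_def
      by (subst cvt_plus.simps)
        (simp add: Let_def cnt_flat sum_list_replicate cnt_FApp_map
          del: upt_Suc cnt.simps(2))
    moreover have "cnt F X a (cvt_minus g a lt F p) =
        of_nat (nat (- c)) + (\<Sum>i = 1..n. X i * cnt F X a (cvt_minus g a lt F (?r i)))"
      using False assms(2) unfolding c_def n_def
      by (subst cvt_minus.simps)
        (simp add: Let_def cnt_flat sum_list_replicate cnt_FApp_map
          del: upt_Suc cnt.simps(2))
    \<comment> \<open>The leading copies of \<open>a\<close> account for \<open>c\<close>, and the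
      induction hypothesis turns each difference of arguments of \<open>F\<close> into a
      reduction.\<close>
    ultimately have "cnt F X a (cvt_plus g a lt F p) - cnt F X a (cvt_minus g a lt F p) =
        of_int (int (nat c) - int (nat (- c))) + (\<Sum>i = 1..n. X i * ?r i)"
      by (simp add: IH sum_subtractf[symmetric] right_diff_distrib[symmetric])
    also have "\<dots> = of_int c + (\<Sum>i = 1..n. group lt n p i)"
      by (simp add: group_eq_reduction)
    also have "\<dots> = p"
      unfolding c_def
      by (rule group_decomposition[symmetric]) (use assms(1) less.prems n_def in auto)
    finally show ?thesis .
  qed
qed

theorem theorem4p9:
  fixes Sig :: "'f set" and ar :: "'f \<Rightarrow> nat" and g a :: 'f
    and n :: nat and p :: int_mpoly and lt :: unknown_orders and F :: fvar
    and U :: "'f equations" and A :: "'f axioms"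
  assumes "finite Sig"
    and "g \<in> Sig" and "ar g = 2"
    and "a \<in> Sig" and "ar a = 0"
    and "n \<ge> 1"
    and "unknowns p \<subseteq> {1..n}"
    and "\<And>q. unknowns q \<subseteq> {1..n} \<Longrightarrow> strict_linear_order_on {1..n} (lt q)"
    and "fvar_arity F = n"
    and "(U, A, F) = induced_asogu g a lt F p"
  shows "p = cnt_r F X a U - cnt_l F X a U \<and> 0 = mul_l F X U - mul_r F X U"
proof -
  have U: "U = {(cvt_minus g a lt F p, cvt_plus g a lt F p)}"
    using assms(10) by (simp add: induced_asogu_def)
  \<comment> \<open>The arities 0 and 2 separate the two symbols.\<close>
  have "a \<noteq> g"
    using assms(3,5) by auto
  then have "cnt F X a (cvt_plus g a lt F p) - cnt F X a (cvt_minus g a lt F p) = p"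
    using assms(7-9) by (intro cnt_cvt_diff) auto
  then show ?thesis
    by (simp add: U cnt_l_def cnt_r_def mul_l_def mul_r_def mul_cvt_eq)
qed

end
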